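(* Let $n$ be a nonnegative integer. The polynomial $\mathcal{A}\bigl((t+q)^n\bigr)$ has an interlacing symmetric decomposition (with respect to $n$) for all real $0\le q\le 1$.
   Context: For $n\ge 0$, the $n$-th Eulerian polynomial is $A_n(t)=\sum_{k=0}^n A_{nk}t^k$, where $A_{nk}$ is the number of permutations $\sigma$ of $\{1,\dots,n\}$ such that $\sigma(i)\ge i$ for exactly $k$ indices $i$ (so $A_0(t)=1$). The map $\mathcal{A}:\mathbb{R}[t]\to\mathbb{R}[t]$ is the $\mathbb{R}$-linear operator determined by $\mathcal{A}(t^n)=A_n(t)$ for all $n\ge 0$. Let $f,g\in\mathbb{R}[t]$ be polynomials with positive leading coefficients and only real zeros. Let $\alpha_1\ge\alpha_2\ge\cdots$ be the zeros of $f$ and $\beta_1\ge\beta_2\ge\cdots$ the zeros of $g$ (with multiplicity). One says $g$ interlaces $f$, written $g\preceq f$, if $\cdots\le\beta_2\le\alpha_2\le\beta_1\le\alpha_1$ (so in particular $\deg g\le\deg f\le\deg g+1$). By convention, also $0\preceq f$ and $f\preceq 0$, where $0$ is the zero polynomial. For a polynomial $f$ of degree at most $n$ there are unique polynomials $a$ and $b$ with $f(t)=a(t)+t\,b(t)$, $a(t)=t^na(1/t)$ and $b(t)=t^{n-1}b(1/t)$; explicitly, $a(t)=\frac{f(t)-t\cdot t^nf(1/t)}{1-t}$ and $b(t)=\frac{t^nf(1/t)-f(t)}{1-t}$. This is the symmetric decomposition of $f$ with respect to $n$. The polynomial $f$ is said to have an interlacing symmetric decomposition if $b$ interlaces $a$,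 i.e. $b\preceq a$. *)

theory Defs
  imports
    "HOL-Analysis.Analysis"
    "HOL-Combinatorics.Permutations"
    "HOL-Computational_Algebra.Polynomial"
begin

definition weak_excedances :: "nat \<Rightarrow> (nat \<Rightarrow> nat) \<Rightarrow> nat set" where
  "weak_excedances n \<sigma> = {i \<in> {1..n}. \<sigma> i \<ge> i}"

definition eulerian_number :: "nat \<Rightarrow> nat \<Rightarrow> nat" where
  "eulerian_number n k = card {\<sigma>. \<sigma> permutes {1..n} \<and> card (weak_excedances n \<sigma>) = k}"

definition eulerian_poly :: "nat \<Rightarrow> real poly" where
  "eulerian_poly n = (\<Sum>k\<le>n. monom (of_nat (eulerian_number n k)) k)"

definition eulerian_op :: "real poly \<Rightarrow> real poly" where
  "eulerian_op f = (\<Sum>i\<le>degree f. smult (coeff f i) (eulerian_poly i))"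

text \<open>The next three facts say that this is the linear operator sending the \<open>n\<close>-th power
  of the variable to the \<open>n\<close>-th Eulerian polynomial.\<close>

lemma eulerian_op_altdef:
  assumes "degree f \<le> N"
  shows "eulerian_op f = (\<Sum>i\<le>N. smult (coeff f i) (eulerian_poly i))"
  unfolding eulerian_op_def using assms
  by (intro sum.mono_neutral_left) (auto simp: coeff_eq_0 not_le)

lemma eulerian_op_monom: "eulerian_op (monom 1 n) = eulerian_poly n"
proof -
  have "eulerian_op (monom 1 n) = (\<Sum>i\<le>n. if i = n then eulerian_poly i else 0)"
    unfolding eulerian_op_altdef[OF degree_monom_le] by (intro sum.cong) auto
  then show ?thesis by simp
qed

lemma eulerian_op_add: "eulerian_op (f + g) = eulerian_op f + eulerian_op g"
proof -
  let ?N = "max (degree f) (degree g)"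
  have N: "degree (f + g) \<le> ?N" "degree f \<le> ?N" "degree g \<le> ?N"
    by (auto simp: degree_add_le_max)
  show ?thesis
    unfolding N[THEN eulerian_op_altdef] by (simp add: smult_add_left sum.distrib)
qed

lemma eulerian_op_smult: "eulerian_op (smult c f) = smult c (eulerian_op f)"
proof -
  have "degree (smult c f) \<le> degree f" by simp
  then have "eulerian_op (smult c f) = (\<Sum>i\<le>degree f. smult (coeff (smult c f) i) (eulerian_poly i))"
    by (rule eulerian_op_altdef)
  then show ?thesis
    unfolding eulerian_op_def[of f] by (simp add: poly_eq_iff coeff_sum sum_distrib_left mult.assoc)
qed

definition only_real_zeros :: "real poly \<Rightarrow> bool" where
  "only_real_zeros f \<longleftrightarrow>
     (\<forall>z :: complex. poly (map_poly of_real f) z = 0 \<longrightarrow> z \<in> \<real>)"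

text \<open>The real zeros with multiplicity, in weakly decreasing order.\<close>

definition zeros_desc :: "real poly \<Rightarrow> real list" where
  "zeros_desc f = rev (sorted_list_of_multiset (proots f))"

text \<open>Polynomials to which the notion of interlacing applies: positive leading coefficient
  (in particular nonzero) and only real zeros.\<close>

definition pos_real_rooted :: "real poly \<Rightarrow> bool" where
  "pos_real_rooted f \<longleftrightarrow> lead_coeff f > 0 \<and> only_real_zeros f"

text \<open>\<open>interlaces g f\<close> is the relation \<open>g \<preceq> f\<close>. The zero polynomial
  interlaces, and is interlaced by, every polynomial in question, itself included. The lists
  of zeros are indexed from 0, so the chain reads
  \<open>\<dots> \<le> \<beta>\<^sub>1 \<le> \<alpha>\<^sub>1 \<le> \<beta>\<^sub>0 \<le> \<alpha>\<^sub>0\<close>.\<close>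

definition interlaces :: "real poly \<Rightarrow> real poly \<Rightarrow> bool" where
  "interlaces g f \<longleftrightarrow>
     (g = 0 \<or> pos_real_rooted g) \<and> (f = 0 \<or> pos_real_rooted f) \<and>
     (g = 0 \<or> f = 0 \<or>
       (degree g \<le> degree f \<and> degree f \<le> degree g + 1 \<and>
        (\<forall>i < degree g. zeros_desc g ! i \<le> zeros_desc f ! i) \<and>
        (\<forall>i. Suc i < degree f \<longrightarrow> zeros_desc f ! Suc i \<le> zeros_desc g ! i)))"

text \<open>The functional equations are required at all nonzero real points, which is the same as
  equality of rational functions. The integer power matters for \<open>n = 0\<close>, where the exponent
  of the second equation is \<open>-1\<close> and the equation forces \<open>b = 0\<close>.\<close>

definition symmetric_decomposition ::
    "nat \<Rightarrow> real poly \<Rightarrow> real poly \<Rightarrow> real poly \<Rightarrow> bool" where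
  "symmetric_decomposition n f a b \<longleftrightarrow>
     f = a + [:0, 1:] * b \<and>
     (\<forall>t. t \<noteq> 0 \<longrightarrow> poly a t = t ^ n * poly a (1 / t)) \<and>
     (\<forall>t. t \<noteq> 0 \<longrightarrow> poly b t = t powi (int n - 1) * poly b (1 / t))"

definition interlacing_symmetric_decomposition :: "nat \<Rightarrow> real poly \<Rightarrow> bool" where
  "interlacing_symmetric_decomposition n f \<longleftrightarrow>
     degree f \<le> n \<and> (\<exists>a b. symmetric_decomposition n f a b \<and> interlaces b a)"

text \<open>The pair \<open>(a, b)\<close> is uniquely determined by \<open>n\<close> and \<open>f\<close>, so the
  existential quantifier above involves no choice.\<close>

lemma symmetric_decomposition_explicit:
  assumes "symmetric_decomposition n f a b" and t: "t \<noteq> 0" "t \<noteq> 1"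
  shows "poly a t = (poly f t - t * (t ^ n * poly f (1 / t))) / (1 - t)"
    and "poly b t = (t ^ n * poly f (1 / t) - poly f t) / (1 - t)"
proof -
  have f: "poly f s = poly a s + s * poly b s" for s
    using assms(1) by (simp add: symmetric_decomposition_def)
  have a: "poly a t = t ^ n * poly a (1 / t)"
    and b: "poly b t = t powi (int n - 1) * poly b (1 / t)"
    using assms(1) t(1) unfolding symmetric_decomposition_def by blast+
  have "t powi (int n - 1) = t ^ n / t"
    using t by (simp add: power_int_diff)
  then have b': "t ^ n * (poly b (1 / t) / t) = poly b t"
    by (subst b) simp
  have refl: "t ^ n * poly f (1 / t) = poly a t + poly b t"
    unfolding f by (subst a, subst b'[symmetric]) (simp add: distrib_left)
  show "poly a t = (poly f t - t * (t ^ n * poly f (1 / t))) / (1 - t)"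
    and "poly b t = (t ^ n * poly f (1 / t) - poly f t) / (1 - t)"
    unfolding refl using t by (simp_all add: f field_simps)
qed

lemma symmetric_decomposition_unique:
  assumes "symmetric_decomposition n f a b" "symmetric_decomposition n f a' b'"
  shows "a = a'" and "b = b'"
proof -
  have "poly (b - b') t = 0" if "t \<notin> {0, 1}" for t
    using that assms[THEN symmetric_decomposition_explicit(2)] by simp
  then have "- {0, 1} \<subseteq> {t. poly (b - b') t = 0}" by blast
  moreover have "infinite (- {0, 1 :: real})"
    by (simp add: Compl_eq_Diff_UNIV infinite_UNIV_char_0)
  ultimately have "infinite {t. poly (b - b') t = 0}"
    using finite_subset by blast
  then show b: "b = b'"
    using poly_roots_finite[of "b - b'"] by auto
  show "a = a'"
    using assms unfolding symmetric_decomposition_def b by (metis add_right_cancel)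
qed

end

theory Submission
  imports Defs
begin

text \<open>
  Write \<open>A\<^sub>k\<close> for the Eulerian polynomials, \<open>F\<^sub>n(q,t) = \<Sum>\<^sub>k (n choose k) q^(n-k) A\<^sub>k(t)\<close> for the image of
  the \<open>n\<close>-th power of \<open>t + q\<close>, and \<open>R\<^sub>n(q,t) = t^n F\<^sub>n(q,1/t)\<close>. The parts of the symmetric
  decomposition satisfy \<open>(1-t) a = F\<^sub>n - t R\<^sub>n\<close> and \<open>(1-t) b = R\<^sub>n - F\<^sub>n\<close>. The idea is to fix a number
  \<open>t < 0\<close> and to study \<open>F\<^sub>n\<close> and \<open>R\<^sub>n\<close> as functions of \<open>q\<close>.

  The palindromicity of \<open>A\<^sub>n\<close> gives \<open>t R\<^sub>n(q) = F\<^sub>n(tq) - (1-t) (tq)^n\<close>, so for \<open>q\<close> in \<open>[0,1]\<close> the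
  values \<open>F\<^sub>n(q)\<close> and \<open>t R\<^sub>n(q)\<close> are the values at \<open>q\<close> and at \<open>tq\<close> of a single function on
  \<open>[t,1]\<close>, the spline \<open>g\<^sub>n(x) = F\<^sub>n(x) - (1-t) (min x 0)^n\<close>. It satisfies \<open>g\<^sub>n' = n g\<^sub>n\<^sub>-\<^sub>1\<close> (an Appell
  sequence), and the convolution identity for Eulerian polynomials says that
  \<open>g\<^sub>n(t) = t g\<^sub>n(1)\<close>. Glueing the ends of \<open>[t,1]\<close> with this sign-reversing factor \<open>t\<close> makes \<open>g\<^sub>n\<close> a
  function on a circle, and the theorem of Rolle on the circle (\<open>twisted_Rolle\<close>) shows that \<open>g\<^sub>n\<close>
  has at most one zero there if \<open>g\<^sub>n\<^sub>-\<^sub>1\<close> does. As \<open>g\<^sub>1\<close> has a single zero, this holds for all \<open>n > 0\<close>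
  (\<open>eulerian_spline_unique_zero\<close>).

  Since \<open>(1-t) a = g\<^sub>n(q) - g\<^sub>n(tq)\<close> and \<open>g\<^sub>n(0) = A\<^sub>n(t)\<close>, this one zero controls the signs of \<open>a\<close>
  and \<open>b\<close>. If \<open>A\<^sub>n(t) = 0\<close>, then the only zero of \<open>g\<^sub>n\<close> is \<open>0\<close>, the function \<open>g\<^sub>n\<close> changes sign there
  with slope \<open>n A\<^sub>n\<^sub>-\<^sub>1(t)\<close>, and \<open>a(t)\<close> has the sign of \<open>A\<^sub>n\<^sub>-\<^sub>1(t)\<close>
  (\<open>eulerian_spline_sign_at_zero\<close>). The zeros of \<open>A\<^sub>n\<^sub>-\<^sub>1\<close> and \<open>A\<^sub>n\<close> interlace
  (\<open>descent_poly_roots\<close>), so these signs alternate along the zeros of \<open>A\<^sub>n\<close>, and \<open>a\<close> has \<open>n\<close>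
  negative zeros separated by them. If \<open>a(t) = 0\<close>, then \<open>g\<^sub>n(q) = g\<^sub>n(tq) = t b(t)\<close>, and
  \<open>g\<^sub>n(0) = A\<^sub>n(t)\<close> must have the same sign, for otherwise \<open>g\<^sub>n\<close> would vanish on either side of \<open>0\<close>
  (\<open>eulerian_spline_sign_at_level\<close>). Hence \<open>b\<close> alternates in sign along the zeros of \<open>a\<close>, which is
  the interlacing. This covers \<open>0 < q < 1\<close> and \<open>n > 0\<close>. For \<open>q = 0\<close> the part \<open>a\<close> vanishes and
  \<open>b = A\<^sub>n / t\<close>; for \<open>q = 1\<close> the part \<open>b\<close> vanishes, and the zeros of \<open>a\<close> are found as above.
\<close>

section \<open>Real polynomials with alternating signs\<close>

lemma strictly_decreasing:
  fixes r :: "nat \<Rightarrow> real"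
  assumes "\<And>i. Suc i < n \<Longrightarrow> r (Suc i) < r i" "i < j" "j < n"
  shows "r j < r i"
  using assms(2,3)
proof (induction j)
  case (Suc j)
  then show ?case
    using assms(1)[of j] by (cases "i = j") fastforce+
qed simp

text \<open>As many distinct real zeros as the degree allows leave no room for a multiple or a
  non-real zero, so they determine the polynomial up to its leading coefficient.\<close>

lemma decreasing_roots:
  fixes p :: "real poly"
  assumes deg: "degree p = n" and p0: "p \<noteq> 0"
    and dec: "\<And>i. Suc i < n \<Longrightarrow> r (Suc i) < r i"
    and root: "\<And>i. i < n \<Longrightarrow> poly p (r i) = 0"
  shows "zeros_desc p = map r [0..<n]"
    and "only_real_zeros p"
    and "p = smult (lead_coeff p) (\<Prod>i<n. [:- r i, 1:])"
proof -
  have lt: "r j < r i" if "i < j" "j < n" for i j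
    using strictly_decreasing[of n r i j] dec that by blast
  have inj: "inj_on r {..<n}"
    by (rule linorder_inj_onI) (use lt in force)+
  have card: "card (r ` {..<n}) = n"
    using inj by (simp add: card_image)
  have "mset_set (r ` {..<n}) \<subseteq># proots p"
    by (rule mset_subset_eqI) (use p0 root in \<open>auto simp: count_mset_set' order_root Suc_le_eq\<close>)
  moreover have "size (proots p) \<le> size (mset_set (r ` {..<n}))"
    using size_proots_le[of p] deg card by simp
  ultimately have proots: "proots p = mset_set (r ` {..<n})"
    by (metis mset_subset_size nless_le not_le subset_mset.le_less)
  have "sorted_list_of_set (r ` {..<n}) = rev (map r [0..<n])"
  proof (rule sorted_list_of_set_unique[THEN iffD1, symmetric, THEN sym])
    show "finite (r ` {..<n})" by simp
    have "sorted_wrt (<) (rev (map r [0..<n]))"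
      unfolding sorted_wrt_rev sorted_wrt_map by (simp add: sorted_wrt_iff_nth_less lt)
    then show "sorted_wrt (<) (rev (map r [0..<n])) \<and> set (rev (map r [0..<n])) = r ` {..<n}
        \<and> length (rev (map r [0..<n])) = card (r ` {..<n})"
      using card by (simp add: atLeast0LessThan)
  qed
  then show "zeros_desc p = map r [0..<n]"
    by (simp add: zeros_desc_def proots)
  show "only_real_zeros p"
  proof -
    let ?P = "map_poly of_real p :: complex poly"
    have P: "degree ?P = n" "?P \<noteq> 0"
      using deg p0 by (simp_all add: degree_map_poly map_poly_eq_0_iff)
    have ev: "poly ?P (of_real x) = of_real (poly p x)" for x
      by (induction p) (simp_all add: map_poly_pCons)
    have "card (of_real ` r ` {..<n} :: complex set) = n"
      using card by (simp add: card_image inj_on_def)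
    then have eq: "{z. poly ?P z = 0} = of_real ` r ` {..<n}"
      by (intro card_seteq[symmetric])
        (use P poly_roots_finite card_poly_roots_bound[OF P(2)] root in \<open>auto simp: ev\<close>)
    have "z \<in> \<real>" if "poly ?P z = 0" for z
    proof -
      from that have "z \<in> of_real ` r ` {..<n}"
        unfolding eq[symmetric] by simp
      then show ?thesis by auto
    qed
    then show ?thesis by (simp add: only_real_zeros_def)
  qed
  show "p = smult (lead_coeff p) (\<Prod>i<n. [:- r i, 1:])"
  proof (rule poly_eqI_degree_lead_coeff[where n = n and A = "r ` {..<n}"])
    show "card (r ` {..<n}) \<ge> n" using card by simp
    have dq: "degree (\<Prod>i<n. [:- r i, 1:]) = n"
      by (subst degree_prod_eq_sum_degree) auto
    then show "degree (smult (lead_coeff p) (\<Prod>i<n. [:- r i, 1:])) \<le> n"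
      using p0 by simp
    have "lead_coeff (\<Prod>i<n. [:- r i, 1:]) = 1"
      by (simp add: lead_coeff_prod)
    then show "coeff p n = coeff (smult (lead_coeff p) (\<Prod>i<n. [:- r i, 1:])) n"
      using dq deg by simp
    show "poly p z = poly (smult (lead_coeff p) (\<Prod>i<n. [:- r i, 1:])) z" if "z \<in> r ` {..<n}" for z
      using that root by (auto simp: poly_prod)
  qed (use deg in simp)
qed

text \<open>The common core of the two sign computations that follow, both of which evaluate a product of
  differences \<open>x - r i\<close> whose first \<open>k\<close> factors are the negative ones.\<close>

lemma sign_prod_split:
  fixes f :: "nat \<Rightarrow> real"
  assumes "k \<le> n" "\<And>i. i < k \<Longrightarrow> f i < 0" "\<And>i. k \<le> i \<Longrightarrow> i < n \<Longrightarrow> f i > 0"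
  shows "(-1) ^ k * (\<Prod>i<n. f i) > 0"
proof -
  have "(\<Prod>i<n. f i) = (\<Prod>i<k. f i) * (\<Prod>i\<in>{k..<n}. f i)"
    using assms(1) by (simp add: prod.atLeastLessThan_concat flip: atLeast0LessThan)
  moreover have "(-1) ^ k * (\<Prod>i<k. f i) = (\<Prod>i<k. - f i)"
    using prod_uminus[of f "{..<k}"] by simp
  moreover have "(\<Prod>i<k. - f i) > 0" "(\<Prod>i\<in>{k..<n}. f i) > 0"
    using assms by (auto intro!: prod_pos)
  ultimately show ?thesis
    by (metis mult.assoc mult_pos_pos)
qed

lemma sign_between_roots:
  fixes p :: "real poly"
  assumes deg: "degree p = n" and lead: "lead_coeff p > 0"
    and dec: "\<And>i. Suc i < n \<Longrightarrow> r (Suc i) < r i"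
    and root: "\<And>i. i < n \<Longrightarrow> poly p (r i) = 0"
    and k: "k \<le> n" "\<And>i. i < k \<Longrightarrow> x < r i" "\<And>i. k \<le> i \<Longrightarrow> i < n \<Longrightarrow> r i < x"
  shows "(-1) ^ k * poly p x > 0"
proof -
  have "p \<noteq> 0" using lead by auto
  have "poly p x = lead_coeff p * (\<Prod>i<n. x - r i)"
    by (subst decreasing_roots(3)[OF deg \<open>p \<noteq> 0\<close>, of r, OF dec root]) (simp_all add: poly_prod)
  moreover have "lead_coeff p * ((-1) ^ k * (\<Prod>i<n. x - r i)) > 0"
    by (intro mult_pos_pos lead sign_prod_split) (use k in auto)
  ultimately show ?thesis by (simp add: mult_ac)
qed

lemma sign_pderiv_at_root:
  fixes p :: "real poly"
  assumes deg: "degree p = n" and lead: "lead_coeff p > 0"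
    and dec: "\<And>i. Suc i < n \<Longrightarrow> r (Suc i) < r i"
    and root: "\<And>i. i < n \<Longrightarrow> poly p (r i) = 0"
    and k: "k < n"
  shows "(-1) ^ k * poly (pderiv p) (r k) > 0"
proof -
  have "p \<noteq> 0" using lead by auto
  have lt: "r j < r i" if "i < j" "j < n" for i j
    using strictly_decreasing[of n r i j] dec that by blast
  define s where "s = smult (lead_coeff p) (\<Prod>i\<in>{..<n} - {k}. [:- r i, 1:])"
  \<comment> \<open>Removing the factor that vanishes at \<open>r k\<close> turns the derivative there into the value of
    the cofactor.\<close>
  have "p = [:- r k, 1:] * s"
    using decreasing_roots(3)[OF deg \<open>p \<noteq> 0\<close>, of r, OF dec root] k
    by (simp add: s_def prod.remove[of "{..<n}" k])
  then have "poly (pderiv p) (r k) = poly s (r k)"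
    by (simp only: pderiv_mult poly_add poly_mult) (simp add: pderiv_pCons)
  also have "\<dots> = lead_coeff p * (\<Prod>i\<in>{..<n} - {k}. r k - r i)"
    by (simp add: s_def poly_prod)
  also have "(\<Prod>i\<in>{..<n} - {k}. r k - r i) = (\<Prod>i<n. if i = k then 1 else r k - r i)"
    using k by (simp add: prod.remove[of "{..<n}" k])
  finally have "poly (pderiv p) (r k) = lead_coeff p * (\<Prod>i<n. if i = k then 1 else r k - r i)" .
  moreover have "lead_coeff p * ((-1) ^ k * (\<Prod>i<n. if i = k then 1 else r k - r i)) > 0"
    by (intro mult_pos_pos lead sign_prod_split) (use k lt in \<open>auto simp: le_less\<close>)
  ultimately show ?thesis by (simp add: mult_ac)
qed

lemma sign_at_minus_infinity:
  fixes p :: "real poly"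
  assumes deg: "degree p = n" and lead: "lead_coeff p > 0"
  shows "\<exists>x < c. (-1) ^ n * poly p x > 0"
proof -
  \<comment> \<open>Reflecting the variable moves the question to \<open>+\<infinity>\<close>, where the leading coefficient decides.\<close>
  define s where "s = smult ((-1) ^ n) (pcompose p [:0, -1:])"
  have "lead_coeff s = lead_coeff p"
    using deg by (simp add: s_def lead_coeff_comp flip: power_mult_distrib)
  then obtain m where m: "\<And>x. x \<ge> m \<Longrightarrow> poly s x \<ge> lead_coeff p"
    using poly_pinfty_gt_lc[of s] lead by auto
  define x where "x = min (- m) (c - 1)"
  have "m \<le> - x"
    by (simp add: x_def min_def)
  then have "poly s (- x) > 0"
    using m[of "- x"] lead by linarith
  then have "(-1) ^ n * poly p x > 0"
    by (simp add: s_def poly_pcompose)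
  moreover have "x < c" by (simp add: x_def)
  ultimately show ?thesis by blast
qed

lemma alternating_signs_roots:
  fixes p :: "real poly"
  assumes dec: "\<And>i. i < n \<Longrightarrow> z (Suc i) < z i"
    and sign: "\<And>i. i \<le> n \<Longrightarrow> (-1) ^ i * poly p (z i) > 0"
  shows "\<exists>r. \<forall>i < n. z (Suc i) < r i \<and> r i < z i \<and> poly p (r i) = 0"
proof -
  have "\<exists>x. z (Suc i) < x \<and> x < z i \<and> poly p x = 0" if "i < n" for i
  proof -
    have "((-1) ^ i * poly p (z i)) * ((-1) ^ Suc i * poly p (z (Suc i))) > 0"
      using that by (intro mult_pos_pos sign) auto
    then have "poly p (z (Suc i)) * poly p (z i) < 0"
      by (simp add: algebra_simps flip: power_add mult_2)
    then show ?thesis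
      using poly_IVT[OF dec[OF that]] by blast
  qed
  then show ?thesis by metis
qed

text \<open>The form in which sign alternation is used below: signs are known at \<open>m\<close> negative points \<open>w\<close>,
  while \<open>0\<close> and \<open>-\<infinity>\<close> supply the two missing sample points for a polynomial of degree \<open>m + 1\<close>. The
  conclusion records how each zero lies relative to every \<open>w j\<close>, so that signs of other
  polynomials with zeros \<open>w\<close> can be read off at the new zeros.\<close>

lemma interlaced_roots:
  fixes p :: "real poly"
  assumes deg: "degree p = Suc m" and lead: "lead_coeff p > 0" and p0: "poly p 0 > 0"
    and neg: "\<And>i. i < m \<Longrightarrow> w i < 0" and dec: "\<And>i. Suc i < m \<Longrightarrow> w (Suc i) < w i"
    and sign: "\<And>i. i < m \<Longrightarrow> (-1) ^ Suc i * poly p (w i) > 0"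
  shows "\<exists>r. (\<forall>i<Suc m. poly p (r i) = 0 \<and> r i < 0 \<and>
      (\<forall>j<i. r i < w j) \<and> (\<forall>j. i \<le> j \<and> j < m \<longrightarrow> w j < r i)) \<and>
    (\<forall>i. Suc i < Suc m \<longrightarrow> r (Suc i) < r i)"
proof -
  \<comment> \<open>The smallest of the sample points \<open>0, w 0, \<dots>, w (m - 1)\<close>; the last point \<open>x\<close> goes to its left.\<close>
  define c where "c = (if m = 0 then 0 else w (m - 1))"
  obtain x where x: "x < c" "(-1) ^ Suc m * poly p x > 0"
    using sign_at_minus_infinity[OF deg lead] by blast
  define z where "z i = (if i = 0 then 0 else if i \<le> m then w (i - 1) else x)" for i
  have zdec: "z (Suc i) < z i" if "i < Suc m" for i
  proof -
    consider "i = 0" "m = 0" | "i = 0" "m > 0" | j where "i = Suc j" "i < m"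
      | j where "i = Suc j" "i = m"
      using \<open>i < Suc m\<close> by (cases i) force+
    then show ?thesis
      by cases (use x neg dec in \<open>auto simp: z_def c_def\<close>)
  qed
  have zsign: "(-1) ^ i * poly p (z i) > 0" if "i \<le> Suc m" for i
  proof -
    consider "i = 0" | j where "i = Suc j" "j < m" | "i = Suc m"
      using \<open>i \<le> Suc m\<close> by (cases i) force+
    then show ?thesis
      by cases (use x sign p0 in \<open>auto simp: z_def\<close>)
  qed
  obtain r where r: "\<And>i. i < Suc m \<Longrightarrow> z (Suc i) < r i \<and> r i < z i \<and> poly p (r i) = 0"
    using alternating_signs_roots[of "Suc m" z p] zdec zsign by blast
  have zle: "z j \<le> z i" if "i \<le> j" "j \<le> Suc m" for i j
    using strictly_decreasing[of "Suc (Suc m)" z i j] zdec that by (cases "i = j") (auto simp: less_imp_le)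
  show ?thesis
  proof (intro exI[of _ r] conjI allI impI)
    show "r (Suc i) < r i" if "Suc i < Suc m" for i
      using r[of i] r[of "Suc i"] that by linarith
    fix i assume i: "i < Suc m"
    show "poly p (r i) = 0" using r[OF i] by blast
    show "r i < 0"
      using r[of i] zle[of 0 i] i by (simp add: z_def)
    show "r i < w j" if "j < i" for j
      using r[of i] zle[of "Suc j" i] i that by (simp add: z_def)
    show "w j < r i" if "i \<le> j \<and> j < m" for j
      using r[of i] zle[of "Suc i" "Suc j"] that by (simp add: z_def)
  qed
qed

lemma pos_real_rootedI:
  assumes "degree p = n" "lead_coeff p > 0" "\<And>i. Suc i < n \<Longrightarrow> r (Suc i) < r i"
    "\<And>i. i < n \<Longrightarrow> poly p (r i) = 0"
  shows "pos_real_rooted p"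
proof -
  have "p \<noteq> 0" using assms(2) by auto
  then show ?thesis
    unfolding pos_real_rooted_def using decreasing_roots(2)[OF assms(1) _, of r, OF _ assms(3,4)] assms(2) by blast
qed

lemma interlacesI:
  assumes f: "degree f = Suc m" "lead_coeff f > 0" "\<And>i. Suc i < Suc m \<Longrightarrow> r (Suc i) < r i"
    "\<And>i. i < Suc m \<Longrightarrow> poly f (r i) = 0"
    and g: "degree g = m" "lead_coeff g > 0"
    and s: "\<And>i. i < m \<Longrightarrow> r (Suc i) < s i \<and> s i < r i \<and> poly g (s i) = 0"
  shows "interlaces g f"
proof -
  have ne: "f \<noteq> 0" "g \<noteq> 0" using f g by auto
  have sdec: "s (Suc i) < s i" if "Suc i < m" for i
    using s[of i] s[of "Suc i"] that by linarith
  have sroot: "poly g (s i) = 0" if "i < m" for i using s that by blast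
  have zeros: "zeros_desc f = map r [0..<Suc m]" "zeros_desc g = map s [0..<m]"
    using decreasing_roots(1)[OF f(1) ne(1), of r, OF f(3,4)]
      decreasing_roots(1)[OF g(1) ne(2), of s, OF sdec sroot] by simp_all
  have rr: "pos_real_rooted f" "pos_real_rooted g"
    using pos_real_rootedI[OF f(1,2), of r, OF f(3,4)] pos_real_rootedI[OF g, of s, OF sdec sroot]
    by simp_all
  have "zeros_desc g ! i \<le> zeros_desc f ! i" if "i < m" for i
    using s[OF that] that by (simp add: zeros del: upt_Suc)
  moreover have "zeros_desc f ! Suc i \<le> zeros_desc g ! i" if "i < m" for i
    using s[OF that] that by (simp add: zeros del: upt_Suc)
  ultimately show ?thesis
    using rr f(1) g(1) by (simp add: interlaces_def)
qed

section \<open>Eulerian polynomials\<close>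

lemma poly_eulerian_poly:
  "poly (eulerian_poly n) t = (\<Sum>\<sigma> | \<sigma> permutes {1..n}. t ^ card (weak_excedances n \<sigma>))"
proof -
  let ?P = "{\<sigma>. \<sigma> permutes {1..n}}" and ?w = "\<lambda>\<sigma>. card (weak_excedances n \<sigma>)"
  have fin: "finite ?P"
    by (simp add: finite_permutations)
  have "?w ` ?P \<subseteq> {..n}"
  proof
    fix k assume "k \<in> ?w ` ?P"
    then obtain \<sigma> where "k = ?w \<sigma>" by blast
    moreover have "?w \<sigma> \<le> card {1..n}"
      by (rule card_mono) (auto simp: weak_excedances_def)
    ultimately show "k \<in> {..n}" by simp
  qed
  then have "(\<Sum>\<sigma>\<in>?P. t ^ ?w \<sigma>) = (\<Sum>k\<le>n. \<Sum>\<sigma> | \<sigma> \<in> ?P \<and> ?w \<sigma> = k. t ^ ?w \<sigma>)"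
    by (intro sum.group[symmetric] fin) auto
  also have "\<dots> = (\<Sum>k\<le>n. real (eulerian_number n k) * t ^ k)"
    by (intro sum.cong) (auto simp: eulerian_number_def)
  also have "\<dots> = poly (eulerian_poly n) t"
    by (simp add: eulerian_poly_def poly_sum poly_monom)
  finally show ?thesis by simp
qed

text \<open>Composing with the transposition inserts \<open>n + 1\<close> into a cycle of \<open>\<sigma>\<close>: the preimage \<open>i\<close> of \<open>b\<close> is
  sent to \<open>n + 1\<close>, and \<open>n + 1\<close> to \<open>b\<close>. So \<open>i\<close> becomes a weak excedance if it was not one, and for
  \<open>b = n + 1\<close> a new fixed point arises.\<close>

lemma card_weak_excedances_insert:
  assumes \<sigma>: "\<sigma> permutes {1..n}" and b: "b \<in> {1..Suc n}"
  shows "card (weak_excedances (Suc n) (Transposition.transpose (Suc n) b \<circ> \<sigma>)) =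
    (if b \<in> \<sigma> ` weak_excedances n \<sigma> then card (weak_excedances n \<sigma>)
     else Suc (card (weak_excedances n \<sigma>)))"
proof -
  let ?W = "weak_excedances n \<sigma>"
  let ?W' = "weak_excedances (Suc n) (Transposition.transpose (Suc n) b \<circ> \<sigma>)"
  have fix_top: "\<sigma> (Suc n) = Suc n"
    using \<sigma> by (auto simp: permutes_def)
  have range: "\<sigma> i \<in> {1..n}" if "i \<in> {1..n}" for i
    using permutes_in_image[OF \<sigma>, of i] that by blast
  have fin: "finite ?W" and sub: "?W \<subseteq> {1..n}"
    by (auto simp: weak_excedances_def)
  show ?thesis
  proof (cases "b = Suc n")
    case True
    have "?W' = insert (Suc n) ?W"
      using fix_top by (auto simp: weak_excedances_def True le_Suc_eq)
    moreover have "b \<notin> \<sigma> ` ?W"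
      using True sub range by fastforce
    ultimately show ?thesis
      using fin sub by (auto simp: card_insert_if)
  next
    case False
    then have bn: "b \<in> {1..n}" using b by auto
    then obtain i where i: "i \<in> {1..n}" "\<sigma> i = b"
      using permutes_image[OF \<sigma>] by (metis imageE)
    have inj: "\<sigma> j = b \<longleftrightarrow> j = i" for j
      using i permutes_inj[OF \<sigma>] by (metis injD)
    have val: "(Transposition.transpose (Suc n) b \<circ> \<sigma>) j = (if j = i then Suc n else if j = Suc n then b else \<sigma> j)"
      if "j \<in> {1..Suc n}" for j
      using that fix_top inj[of j] range[of j] False i
      by (auto simp: transpose_def le_Suc_eq)
    have "?W' = insert i ?W"
    proof (intro set_eqI)
      fix j
      show "j \<in> ?W' \<longleftrightarrow> j \<in> insert i ?W"
      proof (cases "j \<in> {1..Suc n}")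
        case True
        show ?thesis
          unfolding weak_excedances_def mem_Collect_eq val[OF True] insert_iff
          using True i bn by auto
      next
        case False
        then show ?thesis using i by (auto simp: weak_excedances_def)
      qed
    qed
    moreover have "b \<in> \<sigma> ` ?W \<longleftrightarrow> i \<in> ?W"
      using inj by (metis image_iff)
    ultimately show ?thesis
      using fin by (simp add: card_insert_if)
  qed
qed

text \<open>If \<open>\<sigma>\<close> has \<open>w\<close> weak excedances, then \<open>w\<close> of the \<open>n + 1\<close> insertions of \<open>n + 1\<close> keep this number and
  the others raise it by one; the factor \<open>w\<close> is what produces the derivative.\<close>

lemma eulerian_poly_Suc:
  "eulerian_poly (Suc n) =
     [:0, of_nat (Suc n):] * eulerian_poly n + [:0, 1, -1:] * pderiv (eulerian_poly n)"
proof (rule poly_ext)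
  fix t :: real
  let ?P = "{\<sigma>. \<sigma> permutes {1..n}}" and ?w = "\<lambda>\<sigma>. card (weak_excedances n \<sigma>)"
  have ins: "{1..Suc n} = insert (Suc n) {1..n}" by auto
  have inner: "(\<Sum>b\<in>{1..Suc n}. t ^ card (weak_excedances (Suc n) (Transposition.transpose (Suc n) b \<circ> \<sigma>))) =
      real (Suc n) * t * t ^ ?w \<sigma> + t * (1 - t) * (real (?w \<sigma>) * t ^ (?w \<sigma> - 1))"
    if \<sigma>: "\<sigma> \<in> ?P" for \<sigma>
  proof -
    let ?I = "\<sigma> ` weak_excedances n \<sigma>"
    have sub: "?I \<subseteq> {1..Suc n}"
    proof -
      have "?I \<subseteq> \<sigma> ` {1..n}" by (auto simp: weak_excedances_def)
      also have "\<dots> = {1..n}" using \<sigma> by (simp add: permutes_image)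
      finally show ?thesis by auto
    qed
    have cI: "card ?I = ?w \<sigma>"
      using permutes_inj[of \<sigma> "{1..n}"] \<sigma> by (intro card_image) (auto simp: inj_on_def inj_def)
    have le: "?w \<sigma> \<le> Suc n"
      using card_mono[OF _ sub] cI by simp
    have alg: "real w * t ^ w + (real (Suc n) - real w) * t ^ Suc w =
        real (Suc n) * t * t ^ w + t * (1 - t) * (real w * t ^ (w - 1))" for w
      by (cases w) (simp_all add: algebra_simps)
    have "(\<Sum>b\<in>{1..Suc n}. t ^ card (weak_excedances (Suc n) (Transposition.transpose (Suc n) b \<circ> \<sigma>))) =
        (\<Sum>b\<in>{1..Suc n}. if b \<in> ?I then t ^ ?w \<sigma> else t ^ Suc (?w \<sigma>))"
      using \<sigma> by (intro sum.cong) (auto simp: card_weak_excedances_insert simp del: o_apply)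
    also have "\<dots> = (\<Sum>b\<in>{1..Suc n} - ?I. t ^ Suc (?w \<sigma>)) + (\<Sum>b\<in>?I. t ^ ?w \<sigma>)"
      unfolding sum.subset_diff[OF sub finite_atLeastAtMost]
      by (intro arg_cong2[where f = "(+)"] sum.cong) auto
    also have "\<dots> = real (?w \<sigma>) * t ^ ?w \<sigma> + (real (Suc n) - real (?w \<sigma>)) * t ^ Suc (?w \<sigma>)"
      using sub le by (simp add: cI card_Diff_subset finite_subset[OF sub] of_nat_diff)
    also have "\<dots> = real (Suc n) * t * t ^ ?w \<sigma> + t * (1 - t) * (real (?w \<sigma>) * t ^ (?w \<sigma> - 1))"
      by (rule alg)
    finally show ?thesis .
  qed
  have "poly (eulerian_poly (Suc n)) t =
      (\<Sum>b\<in>{1..Suc n}. \<Sum>\<sigma>\<in>?P. t ^ card (weak_excedances (Suc n) (Transposition.transpose (Suc n) b \<circ> \<sigma>)))"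
    unfolding poly_eulerian_poly ins by (rule sum_over_permutations_insert) auto
  also have "\<dots> = (\<Sum>\<sigma>\<in>?P. real (Suc n) * t * t ^ ?w \<sigma> + t * (1 - t) * (real (?w \<sigma>) * t ^ (?w \<sigma> - 1)))"
    by (subst sum.swap) (intro sum.cong refl inner)
  also have "\<dots> = real (Suc n) * t * poly (eulerian_poly n) t
      + t * (1 - t) * (\<Sum>\<sigma>\<in>?P. real (?w \<sigma>) * t ^ (?w \<sigma> - 1))"
    by (simp add: sum.distrib sum_distrib_left poly_eulerian_poly)
  also have "(\<Sum>\<sigma>\<in>?P. real (?w \<sigma>) * t ^ (?w \<sigma> - 1)) = poly (pderiv (eulerian_poly n)) t"
  proof -
    have "((\<lambda>t. \<Sum>\<sigma>\<in>?P. t ^ ?w \<sigma>) has_field_derivative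
        (\<Sum>\<sigma>\<in>?P. real (?w \<sigma>) * t ^ (?w \<sigma> - 1))) (at t)"
      by (auto intro!: derivative_eq_intros)
    then show ?thesis
      using poly_DERIV[of "eulerian_poly n" t] by (metis (no_types, lifting) DERIV_unique poly_eulerian_poly ext)
  qed
  finally show "poly (eulerian_poly (Suc n)) t = poly ([:0, of_nat (Suc n):] * eulerian_poly n
      + [:0, 1, -1:] * pderiv (eulerian_poly n)) t"
    by (simp add: algebra_simps)
qed

lemma eulerian_poly_0: "eulerian_poly 0 = 1"
  by (rule poly_ext) (simp add: poly_eulerian_poly weak_excedances_def)

text \<open>The Eulerian polynomials in their other normalisation, which counts permutations of
  \<open>{1..m+1}\<close> by descents. Unlike \<open>eulerian_poly (m+1)\<close>, of which they are the quotient by \<open>t\<close>, they do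
  not vanish at \<open>0\<close>; all their zeros turn out to be negative.\<close>

primrec descent_poly :: "nat \<Rightarrow> real poly" where
  "descent_poly 0 = 1"
| "descent_poly (Suc m) =
     [:1, of_nat (Suc m):] * descent_poly m + [:0, 1, -1:] * pderiv (descent_poly m)"

lemma eulerian_poly_Suc_eq: "eulerian_poly (Suc m) = [:0, 1:] * descent_poly m"
proof (induction m)
  case 0
  show ?case by (simp add: eulerian_poly_Suc eulerian_poly_0 pderiv_1)
next
  case (Suc m)
  show ?case
    unfolding eulerian_poly_Suc[of "Suc m"] Suc.IH
    by (rule poly_ext) (simp add: pderiv_mult pderiv_pCons algebra_simps)
qed

lemma descent_poly_degree_coeff:
  "degree (descent_poly m) \<le> m \<and> coeff (descent_poly m) m = 1 \<and> coeff (descent_poly m) 0 = 1"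
proof (induction m)
  case 0
  show ?case by simp
next
  case (Suc m)
  let ?E = "descent_poly m"
  have rec: "coeff (descent_poly (Suc m)) k = coeff ?E k + (if k = 0 then 0 else
      real (Suc m) * coeff ?E (k - 1) + real k * coeff ?E k - real (k - 1) * coeff ?E (k - 1))" for k
    by (cases k; cases "k - 1") (simp_all add: coeff_pCons coeff_pderiv algebra_simps split: nat.splits)
  have zero: "coeff ?E k = 0" if "k > m" for k
    using Suc.IH that by (auto intro: coeff_eq_0)
  have "degree (descent_poly (Suc m)) \<le> Suc m"
    by (rule degree_le) (use zero rec in \<open>auto simp del: descent_poly.simps\<close>)
  moreover have "coeff (descent_poly (Suc m)) (Suc m) = 1"
    using Suc.IH zero[of "Suc m"] by (simp add: rec del: descent_poly.simps)
  moreover have "coeff (descent_poly (Suc m)) 0 = 1"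
    using Suc.IH by (simp add: rec del: descent_poly.simps)
  ultimately show ?case by blast
qed

lemma degree_descent_poly: "degree (descent_poly m) = m"
  and lead_coeff_descent_poly: "coeff (descent_poly m) m = 1"
  and descent_poly_at_0: "poly (descent_poly m) 0 = 1"
  using descent_poly_degree_coeff[of m] le_degree[of "descent_poly m" m]
  by (auto simp: poly_0_coeff_0)

text \<open>Differentiating the identity for \<open>m\<close> expresses the derivative at \<open>1 / t\<close> by the one at \<open>t\<close>, and
  with this the recurrence is seen to be invariant under reversal.\<close>

lemma descent_poly_palindromic:
  assumes "t \<noteq> 0"
  shows "t ^ m * poly (descent_poly m) (1 / t) = poly (descent_poly m) t"
  using assms
proof (induction m arbitrary: t)
  case 0
  show ?case by simp
next
  case (Suc m)
  let ?E = "descent_poly m"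
  let ?d = "\<lambda>t. poly (pderiv ?E) t"
  have lhs: "((\<lambda>t. t ^ m * poly ?E (1 / t)) has_real_derivative
      real m * t ^ (m - 1) * poly ?E (1 / t) - t ^ m * (?d (1 / t) / t ^ 2)) (at t)"
    using Suc.prems by (auto intro!: derivative_eq_intros simp: power2_eq_square)
  have ev: "eventually (\<lambda>t. t ^ m * poly ?E (1 / t) = poly ?E t) (nhds t)"
  proof (rule eventually_mono)
    show "eventually (\<lambda>t. t \<in> - {0}) (nhds t)"
      using Suc.prems by (intro eventually_nhds_in_open) auto
    show "s ^ m * poly ?E (1 / s) = poly ?E s" if "s \<in> - {0}" for s
      by (rule Suc.IH) (use that in simp)
  qed
  from lhs have "(poly ?E has_real_derivative
      real m * t ^ (m - 1) * poly ?E (1 / t) - t ^ m * (?d (1 / t) / t ^ 2)) (at t)"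
    by (rule DERIV_cong_ev[OF refl ev refl, THEN iffD1])
  then have d: "?d t = real m * t ^ (m - 1) * poly ?E (1 / t) - t ^ m * (?d (1 / t) / t ^ 2)"
    by (rule DERIV_unique[OF poly_DERIV])
  have alg: "t * P * ((1 + (1 + c) / t) * X + (1 / t - 1 / t ^ 2) * D) =
      (1 + (1 + c) * t) * (P * X) + (t - t ^ 2) * (c * P / t * X - P * (D / t ^ 2))" for P X D c
    using Suc.prems by (simp add: divide_simps) (simp add: algebra_simps power2_eq_square)
  have "?d t = real m * t ^ m / t * poly ?E (1 / t) - t ^ m * (?d (1 / t) / t ^ 2)"
    unfolding d using Suc.prems by (cases m) auto
  moreover have "poly ?E t = t ^ m * poly ?E (1 / t)"
    by (rule Suc.IH[symmetric]) (rule Suc.prems)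
  moreover have "poly (descent_poly (Suc m)) s =
      (1 + (1 + real m) * s) * poly ?E s + (s - s ^ 2) * ?d s" for s
    by (simp add: algebra_simps power2_eq_square)
  ultimately show ?case
    using alg[of "t ^ m" "real m" "poly ?E (1 / t)" "?d (1 / t)"]
    by (simp only: power_Suc power_divide power_one times_divide_eq_right mult_1_right)
qed

text \<open>At a zero \<open>w i\<close> of the \<open>m\<close>-th polynomial the recurrence reduces to
  \<open>w i * (1 - w i)\<close> times the derivative, whose sign alternates; so the next polynomial has zeros
  separated by the \<open>w i\<close>. The sign condition expresses this interlacing of consecutive
  polynomials. For \<open>m = 0\<close> there is nothing to say, so the truncated \<open>m - 1\<close> is harmless.\<close>

lemma descent_poly_roots:
  "\<exists>w. (\<forall>i<m. poly (descent_poly m) (w i) = 0 \<and> w i < 0 \<and>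
      (-1) ^ i * poly (descent_poly (m - 1)) (w i) > 0) \<and> (\<forall>i. Suc i < m \<longrightarrow> w (Suc i) < w i)"
proof (induction m)
  case (Suc m)
  let ?E = "descent_poly m"
  obtain w where w: "\<And>i. i < m \<Longrightarrow> poly ?E (w i) = 0" "\<And>i. i < m \<Longrightarrow> w i < 0"
      "\<And>i. Suc i < m \<Longrightarrow> w (Suc i) < w i"
    using Suc.IH by blast
  have lead: "lead_coeff ?E > 0"
    by (simp add: degree_descent_poly lead_coeff_descent_poly)
  have sign: "(-1) ^ Suc i * poly (descent_poly (Suc m)) (w i) > 0" if "i < m" for i
  proof -
    have "poly (descent_poly (Suc m)) (w i) = w i * (1 - w i) * poly (pderiv ?E) (w i)"
      using w(1)[OF that] by (simp add: algebra_simps)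
    moreover have "(- w i) * (1 - w i) * ((-1) ^ i * poly (pderiv ?E) (w i)) > 0"
      using w(2)[OF that]
      by (intro mult_pos_pos sign_pderiv_at_root[OF degree_descent_poly lead, of w, OF w(3) w(1) that])
        auto
    ultimately show ?thesis by (simp add: mult_ac)
  qed
  have lead': "lead_coeff (descent_poly (Suc m)) > 0"
    unfolding degree_descent_poly lead_coeff_descent_poly by simp
  have p0: "poly (descent_poly (Suc m)) 0 > 0"
    unfolding descent_poly_at_0 by simp
  obtain r where r: "\<forall>i<Suc m. poly (descent_poly (Suc m)) (r i) = 0 \<and> r i < 0 \<and>
        (\<forall>j<i. r i < w j) \<and> (\<forall>j. i \<le> j \<and> j < m \<longrightarrow> w j < r i)"
      "\<forall>i. Suc i < Suc m \<longrightarrow> r (Suc i) < r i"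
    by (rule interlaced_roots[where w = w, OF degree_descent_poly lead' p0 w(2,3) sign, THEN exE];
      (assumption | (elim conjE, rule that; assumption)))
  have "(-1) ^ i * poly ?E (r i) > 0" if "i < Suc m" for i
    by (rule sign_between_roots[OF degree_descent_poly lead, of w, OF w(3) w(1)])
      (use that r(1) in auto)
  then show ?case using r by auto
qed simp

section \<open>The Eulerian operator on powers of a linear polynomial\<close>

lemma eulerian_op_sum: "eulerian_op (sum f S) = (\<Sum>x\<in>S. eulerian_op (f x))"
proof (induction S rule: infinite_finite_induct)
  case (insert x S)
  then show ?case by (simp add: eulerian_op_add)
qed (simp_all add: eulerian_op_def)

lemma poly_eulerian_op_linear_power:
  "poly (eulerian_op ([:q, 1:] ^ n)) t =
     (\<Sum>k\<le>n. real (n choose k) * q ^ (n - k) * poly (eulerian_poly k) t)"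
proof -
  have "degree ([:q, 1:] ^ n) \<le> n"
    by (rule order.trans[OF degree_power_le]) simp
  then show ?thesis
    by (simp add: eulerian_op_altdef poly_sum coeff_linear_poly_power)
qed

text \<open>The polynomials \<open>F\<^sub>n\<close> form an Appell sequence in \<open>q\<close>, hence satisfy a binomial addition theorem.\<close>

lemma eulerian_op_linear_power_add:
  "eulerian_op ([:q + h, 1:] ^ n) =
     (\<Sum>k\<le>n. smult (real (n choose k) * q ^ (n - k)) (eulerian_op ([:h, 1:] ^ k)))"
proof -
  have "[:q + h, 1:] ^ n = ([:h, 1:] + [:q:]) ^ n" by (simp add: add.commute)
  also have "\<dots> = (\<Sum>k\<le>n. smult (real (n choose k) * q ^ (n - k)) ([:h, 1:] ^ k))"
    unfolding binomial_ring
    by (intro sum.cong) (simp_all add: poly_const_pow of_nat_poly mult_ac)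
  finally show ?thesis
    by (simp add: eulerian_op_sum eulerian_op_smult)
qed

text \<open>Pascal's rule for binomial convolutions: raising \<open>n\<close> amounts to replacing \<open>f k\<close> by
  \<open>f (k + 1) + c f k\<close>.\<close>

lemma binomial_sum_Suc:
  fixes c :: "'a :: comm_ring_1"
  shows "(\<Sum>k\<le>Suc n. of_nat (Suc n choose k) * c ^ (Suc n - k) * f k) =
    (\<Sum>k\<le>n. of_nat (n choose k) * c ^ (n - k) * (f (Suc k) + c * f k))"
proof -
  have "(\<Sum>k\<le>Suc n. of_nat (Suc n choose k) * c ^ (Suc n - k) * f k) =
      c ^ Suc n * f 0 + (\<Sum>k\<le>n. of_nat (n choose Suc k) * c ^ (n - k) * f (Suc k))
      + (\<Sum>k\<le>n. of_nat (n choose k) * c ^ (n - k) * f (Suc k))"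
    unfolding sum.atMost_Suc_shift by (simp add: algebra_simps sum.distrib)
  also have "c ^ Suc n * f 0 + (\<Sum>k\<le>n. of_nat (n choose Suc k) * c ^ (n - k) * f (Suc k)) =
      (\<Sum>k\<le>Suc n. of_nat (n choose k) * c ^ (Suc n - k) * f k)"
    unfolding sum.atMost_Suc_shift by simp
  also have "\<dots> = (\<Sum>k\<le>n. of_nat (n choose k) * c ^ (n - k) * (c * f k))"
    by (simp add: Suc_diff_le mult_ac binomial_eq_0)
  finally show ?thesis
    by (simp add: sum.distrib distrib_left add.commute)
qed

text \<open>In terms of the generating series \<open>S\<^sub>n = \<Sum>\<^sub>j j^n t^j = A\<^sub>n(t) / (1-t)^(n+1)\<close> this is, for
  \<open>n > 0\<close>, the shift of the summation index, \<open>S\<^sub>n = t \<Sum>\<^sub>j (j+1)^n t^j\<close>, expanded binomially. The proof stays with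
  polynomials: both sides obey the recurrence of \<open>eulerian_poly_Suc\<close>.\<close>

lemma eulerian_poly_convolution:
  assumes "n > 0"
  shows "t * poly (eulerian_op ([:1 - t, 1:] ^ n)) t = poly (eulerian_poly n) t"
  unfolding poly_eulerian_op_linear_power using assms
proof (induction n arbitrary: t rule: nat_induct_non_zero)
  case 1
  show ?case by (simp add: eulerian_poly_Suc eulerian_poly_0 pderiv_1)
next
  case (Suc n)
  let ?A = "\<lambda>k. poly (eulerian_poly k)" and ?A' = "\<lambda>k. poly (pderiv (eulerian_poly k))"
  let ?S = "\<lambda>t. \<Sum>k\<le>n. real (n choose k) * (1 - t) ^ (n - k) * ?A k t"
  let ?S' = "\<Sum>k\<le>n. real (n choose k) *
      ((1 - t) ^ (n - k) * ?A' k t - real (n - k) * (1 - t) ^ (n - k - 1) * ?A k t)"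
  have "(?S has_real_derivative ?S') (at t)"
    by (auto intro!: derivative_eq_intros sum.cong simp: algebra_simps)
  then have "((\<lambda>t. t * ?S t) has_real_derivative ?S t + t * ?S') (at t)"
    by (rule DERIV_cong[OF DERIV_mult[OF DERIV_ident]]) (simp only: mult_1_left mult.commute add.commute)
  moreover have "(\<lambda>t. t * ?S t) = ?A n"
    using Suc.IH by auto
  ultimately have "(?A n has_real_derivative ?S t + t * ?S') (at t)"
    by simp
  then have d: "?A' n t = ?S t + t * ?S'"
    by (rule DERIV_unique[OF poly_DERIV])
  have term_eq: "real (Suc n) * t * ((1 - t) ^ (n - k) * ?A k t) + (1 - t) * ((1 - t) ^ (n - k) * ?A k t
        + t * ((1 - t) ^ (n - k) * ?A' k t - real (n - k) * (1 - t) ^ (n - k - 1) * ?A k t)) =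
      (1 - t) ^ (n - k) * (?A (Suc k) t + (1 - t) * ?A k t)" if k: "k \<le> n" for k
  proof -
    have "(1 - t) * (real (n - k) * (1 - t) ^ (n - k - 1)) = (real n - real k) * (1 - t) ^ (n - k)"
      using k by (cases "n - k") (auto simp: of_nat_diff)
    moreover have "?A (Suc k) t = real (Suc k) * t * ?A k t + t * (1 - t) * ?A' k t"
      by (simp add: eulerian_poly_Suc algebra_simps)
    moreover have "(1 + N) * t * (P * X) + (1 - t) * (P * X + t * (P * Y - D * X)) =
        P * (((1 + K) * t * X + t * (1 - t) * Y) + (1 - t) * X)"
      if "(1 - t) * D = (N - K) * P" for N K P X Y D :: real
      using that by algebra
    ultimately show ?thesis by (simp only: of_nat_Suc)
  qed
  have "?A (Suc n) t = real (Suc n) * t * ?A n t + t * (1 - t) * ?A' n t"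
    by (simp add: eulerian_poly_Suc algebra_simps)
  also have "\<dots> = t * (real (Suc n) * t * ?S t + (1 - t) * (?S t + t * ?S'))"
  proof -
    have "c * t * (t * S) + t * (1 - t) * (S + t * S') = t * (c * t * S + (1 - t) * (S + t * S'))"
      for c S S' :: real
      by algebra
    from this[of "real (Suc n)" "?S t" ?S'] show ?thesis
      unfolding d Suc.IH[of t] .
  qed
  also have "real (Suc n) * t * ?S t + (1 - t) * (?S t + t * ?S') =
      (\<Sum>k\<le>n. real (Suc n) * t * (real (n choose k) * (1 - t) ^ (n - k) * ?A k t)
        + (1 - t) * (real (n choose k) * (1 - t) ^ (n - k) * ?A k t
        + t * (real (n choose k) * ((1 - t) ^ (n - k) * ?A' k t - real (n - k) * (1 - t) ^ (n - k - 1) * ?A k t))))"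
    by (simp only: sum_distrib_left sum.distrib[symmetric])
  also have "\<dots> = (\<Sum>k\<le>n. real (n choose k) * (1 - t) ^ (n - k) * (?A (Suc k) t + (1 - t) * ?A k t))"
  proof (intro sum.cong refl)
    fix k assume "k \<in> {..n}"
    moreover have "N * t * (C * P * X) + (1 - t) * (C * P * X + t * (C * Y)) =
        C * (N * t * (P * X) + (1 - t) * (P * X + t * Y))" for N C P X Y :: real
      by algebra
    ultimately show "real (Suc n) * t * (real (n choose k) * (1 - t) ^ (n - k) * ?A k t)
        + (1 - t) * (real (n choose k) * (1 - t) ^ (n - k) * ?A k t
        + t * (real (n choose k) * ((1 - t) ^ (n - k) * ?A' k t - real (n - k) * (1 - t) ^ (n - k - 1) * ?A k t))) =
        real (n choose k) * (1 - t) ^ (n - k) * (?A (Suc k) t + (1 - t) * ?A k t)"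
      using term_eq[of k] by (simp only: atMost_iff mult.assoc)
  qed
  also have "\<dots> = (\<Sum>k\<le>Suc n. real (Suc n choose k) * (1 - t) ^ (Suc n - k) * ?A k t)"
    by (rule binomial_sum_Suc[symmetric])
  finally show ?case by simp
qed

lemma eulerian_poly_palindromic:
  assumes "t \<noteq> 0" "k > 0"
  shows "t * t ^ k * poly (eulerian_poly k) (1 / t) = poly (eulerian_poly k) t"
  using assms descent_poly_palindromic[of t "k - 1"]
  by (cases k) (simp_all add: eulerian_poly_Suc_eq field_simps)

text \<open>The boundary condition \<open>g\<^sub>n(t) = t g\<^sub>n(1)\<close> for the spline of the introduction. By the addition
  theorem \<open>F\<^sub>n(1) = F\<^sub>n(t + (1-t))\<close> is a combination of the \<open>F\<^sub>k(1-t)\<close>, which the convolution identity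
  turns back into Eulerian polynomials; only \<open>k = 0\<close> leaves a correction.\<close>

lemma eulerian_op_linear_power_twist:
  "poly (eulerian_op ([:t, 1:] ^ n)) t - (1 - t) * t ^ n = t * poly (eulerian_op ([:1, 1:] ^ n)) t"
proof -
  let ?F = "\<lambda>k. poly (eulerian_op ([:1 - t, 1:] ^ k)) t"
  have F: "t * ?F k = poly (eulerian_poly k) t - (if k = 0 then 1 - t else 0)" for k
    using eulerian_poly_convolution[of k t]
    by (cases k) (simp_all add: eulerian_op_monom[of 0, simplified] eulerian_poly_0)
  have "t * poly (eulerian_op ([:t + (1 - t), 1:] ^ n)) t =
      (\<Sum>k\<le>n. real (n choose k) * t ^ (n - k) * (t * ?F k))"
    unfolding eulerian_op_linear_power_add by (simp add: poly_sum sum_distrib_left mult_ac)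
  also have "\<dots> = (\<Sum>k\<le>n. real (n choose k) * t ^ (n - k) * poly (eulerian_poly k) t)
      - (\<Sum>k\<le>n. if k = 0 then t ^ n * (1 - t) else 0)"
    unfolding F sum_subtractf[symmetric] by (intro sum.cong) (auto simp: algebra_simps)
  finally show ?thesis
    by (simp add: poly_eulerian_op_linear_power mult.commute)
qed

text \<open>Palindromicity gives \<open>t t^k A\<^sub>k(1/t) = A\<^sub>k(t)\<close> for \<open>k > 0\<close>, while \<open>k = 0\<close> yields \<open>t\<close> instead of \<open>1\<close>,
  which accounts for the last term.\<close>

lemma eulerian_op_linear_power_reversal:
  assumes t: "t \<noteq> 0"
  shows "t * (t ^ n * poly (eulerian_op ([:q, 1:] ^ n)) (1 / t)) =
    poly (eulerian_op ([:t * q, 1:] ^ n)) t - (1 - t) * (t * q) ^ n"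
proof -
  have "t * (t ^ n * poly (eulerian_op ([:q, 1:] ^ n)) (1 / t)) =
      (\<Sum>k\<le>n. real (n choose k) * (t * q) ^ (n - k) * (t * t ^ k * poly (eulerian_poly k) (1 / t)))"
    unfolding poly_eulerian_op_linear_power sum_distrib_left
  proof (intro sum.cong refl)
    fix k assume "k \<in> {..n}"
    then have "t ^ n = t ^ (n - k) * t ^ k"
      by (simp flip: power_add)
    then show "t * (t ^ n * (real (n choose k) * q ^ (n - k) * poly (eulerian_poly k) (1 / t))) =
        real (n choose k) * (t * q) ^ (n - k) * (t * t ^ k * poly (eulerian_poly k) (1 / t))"
      by (simp add: power_mult_distrib mult_ac)
  qed
  also have "\<dots> = (\<Sum>k\<le>n. real (n choose k) * (t * q) ^ (n - k) * poly (eulerian_poly k) t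
      - (if k = 0 then (1 - t) * (t * q) ^ n else 0))"
    using eulerian_poly_palindromic[OF t]
    by (intro sum.cong refl) (auto simp: eulerian_poly_0 algebra_simps)
  also have "\<dots> = poly (eulerian_op ([:t * q, 1:] ^ n)) t - (1 - t) * (t * q) ^ n"
    by (simp add: sum_subtractf poly_eulerian_op_linear_power)
  finally show ?thesis .
qed

lemma degree_eulerian_op_linear_power:
  "degree (eulerian_op ([:q, 1:] ^ n)) = n" "lead_coeff (eulerian_op ([:q, 1:] ^ n)) = 1"
  "poly (eulerian_op ([:q, 1:] ^ n)) 0 = q ^ n"
proof -
  have A: "degree (eulerian_poly k) = k \<and> coeff (eulerian_poly k) k = 1 \<and>
      poly (eulerian_poly k) 0 = (if k = 0 then 1 else 0)" for k
  proof (cases k)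
    case (Suc l)
    have "descent_poly l \<noteq> 0"
      using lead_coeff_descent_poly[of l] by auto
    then show ?thesis
      by (simp add: Suc eulerian_poly_Suc_eq degree_descent_poly lead_coeff_descent_poly)
  qed (simp add: eulerian_poly_0)
  have F: "eulerian_op ([:q, 1:] ^ n) =
      (\<Sum>k\<le>n. smult (real (n choose k) * q ^ (n - k)) (eulerian_poly k))"
    by (rule poly_ext) (simp add: poly_eulerian_op_linear_power poly_sum)
  have le: "degree (eulerian_op ([:q, 1:] ^ n)) \<le> n"
    unfolding F by (intro degree_sum_le) (auto intro: order.trans[OF degree_smult_le] simp: A)
  have "coeff (eulerian_op ([:q, 1:] ^ n)) n = (\<Sum>k\<le>n. if k = n then 1 else 0)"
    unfolding F coeff_sum by (intro sum.cong) (auto simp: A coeff_eq_0)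
  then have c: "coeff (eulerian_op ([:q, 1:] ^ n)) n = 1" by simp
  then show "degree (eulerian_op ([:q, 1:] ^ n)) = n"
    using le le_degree[of "eulerian_op ([:q, 1:] ^ n)" n] by simp
  then show "lead_coeff (eulerian_op ([:q, 1:] ^ n)) = 1"
    using c by simp
  have "poly (eulerian_op ([:q, 1:] ^ n)) 0 = (\<Sum>k\<le>n. if k = 0 then q ^ n else 0)"
    unfolding poly_eulerian_op_linear_power by (intro sum.cong) (auto simp: A)
  then show "poly (eulerian_op ([:q, 1:] ^ n)) 0 = q ^ n" by simp
qed

section \<open>Zeros of the Eulerian spline at a fixed negative argument\<close>

text \<open>Suppose \<open>f\<close> has two zeros \<open>x < y\<close>. The zero \<open>z\<close> of \<open>f'\<close> between them is then the only one, so \<open>f'\<close> has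
  constant sign from \<open>z\<close> through \<open>y\<close> up to \<open>b\<close>, and the opposite sign from \<open>a\<close> through \<open>x\<close> up to \<open>z\<close>,
  as \<open>f' a = t * f' b\<close>. Moving away from the zeros, \<open>f b\<close> and \<open>f a\<close> thus acquire the same sign,
  against \<open>f a = t * f b\<close>. The assumption \<open>f' b > 0\<close> fixes the sign, which may be changed by
  passing to \<open>-f\<close>.\<close>

lemma twisted_Rolle_aux:
  fixes f f' :: "real \<Rightarrow> real"
  assumes t: "t < 0" and f: "\<And>x. (f has_real_derivative f' x) (at x)"
    and cont: "\<And>x. isCont f' x"
    and per: "f a = t * f b" "f' a = t * f' b"
    and uniq: "\<And>x y. x \<in> {a..<b} \<Longrightarrow> y \<in> {a..<b} \<Longrightarrow> f' x = 0 \<Longrightarrow> f' y = 0 \<Longrightarrow> x = y"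
    and xy: "a \<le> x" "x < y" "y < b" "f x = 0" "f y = 0"
    and pos: "f' b > 0"
  shows False
proof -
  obtain z where z: "x < z" "z < y" "f' z = 0"
    using MVT2[of x y f f'] xy f by auto
  have only: "f' w \<noteq> 0" if "w \<in> {a..b}" "w \<noteq> z" for w
    using uniq[of w z] that z xy pos by (cases "w = b") auto
  have right: "f' w > 0" if w: "z < w" "w \<le> b" for w
  proof (rule ccontr)
    assume "\<not> f' w > 0"
    then obtain v where "w \<le> v" "v \<le> b" "f' v = 0"
      using IVT[of f' w 0 b] w cont pos by auto
    then show False using only[of v] w z xy by auto
  qed
  have neg: "f' a < 0" using per t pos by (simp add: mult_less_0_iff)
  have left: "f' w < 0" if w: "a \<le> w" "w < z" for w
  proof (rule ccontr)
    assume "\<not> f' w < 0"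
    then obtain v where "a \<le> v" "v \<le> w" "f' v = 0"
      using IVT[of f' a 0 w] w cont neg by auto
    then show False using only[of v] w z xy by auto
  qed
  have "f b > f y"
    by (rule DERIV_pos_imp_increasing) (use xy z f right in force)+
  then have "f a < 0"
    using per t xy by (simp add: mult_less_0_iff)
  moreover have "f a > f x" if "a < x"
    by (rule DERIV_neg_imp_decreasing) (use that xy z f left in force)+
  ultimately show False using xy by (cases "a = x") auto
qed

text \<open>Rolle's theorem on the circle obtained from \<open>[a,b]\<close> by identifying the ends with a negative
  factor: if \<open>f'\<close> has at most one zero, then so has \<open>f\<close>. The half-open interval counts the common
  end point once.\<close>

lemma twisted_Rolle:
  fixes f f' :: "real \<Rightarrow> real"
  assumes t: "t < 0" and f: "\<And>x. (f has_real_derivative f' x) (at x)"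
    and cont: "\<And>x. isCont f' x"
    and per: "f a = t * f b" "f' a = t * f' b"
    and uniq: "\<And>x y. x \<in> {a..<b} \<Longrightarrow> y \<in> {a..<b} \<Longrightarrow> f' x = 0 \<Longrightarrow> f' y = 0 \<Longrightarrow> x = y"
    and xy: "x \<in> {a..<b}" "y \<in> {a..<b}" "f x = 0" "f y = 0"
  shows "x = y"
proof (rule ccontr)
  assume "x \<noteq> y"
  define u v where "u = min x y" and "v = max x y"
  have uv: "a \<le> u" "u < v" "v < b" "f u = 0" "f v = 0"
    using xy \<open>x \<noteq> y\<close> by (auto simp: u_def v_def min_def max_def)
  consider "f' b > 0" | "f' b < 0" | "f' b = 0" by linarith
  then show False
  proof cases
    case 1
    show False by (rule twisted_Rolle_aux[OF t f cont per uniq uv 1])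
  next
    case 2
    show False
      by (rule twisted_Rolle_aux[where f = "\<lambda>x. - f x" and f' = "\<lambda>x. - f' x", OF t _ _ _ _ _ uv(1-3)])
        (use 2 per uv uniq f cont in \<open>auto intro!: derivative_eq_intros\<close>)
  next
    case 3
    obtain z where z: "u < z" "z < v" "f' z = 0"
      using MVT2[of u v f f'] uv f by auto
    then show False using uniq[of a z] 3 per uv by auto
  qed
qed

text \<open>For fixed \<open>t < 0\<close> this combines \<open>F\<^sub>n\<close>, on \<open>[0,1]\<close>, and \<open>t R\<^sub>n\<close>, rescaled to \<open>[t,0]\<close>, in one function:
  the truncated power is the correction in \<open>eulerian_op_linear_power_reversal\<close>.\<close>

definition eulerian_spline :: "real \<Rightarrow> nat \<Rightarrow> real \<Rightarrow> real" where
  "eulerian_spline t n q = poly (eulerian_op ([:q, 1:] ^ n)) t - (1 - t) * min q 0 ^ n"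

lemma eulerian_spline_nonneg:
  "n > 0 \<Longrightarrow> q \<ge> 0 \<Longrightarrow> eulerian_spline t n q = poly (eulerian_op ([:q, 1:] ^ n)) t"
  by (simp add: eulerian_spline_def)

lemma eulerian_spline_reversal:
  assumes "t < 0" "q \<ge> 0"
  shows "eulerian_spline t n (t * q) = t * (t ^ n * poly (eulerian_op ([:q, 1:] ^ n)) (1 / t))"
proof -
  have "t * q \<le> 0" using assms by (simp add: mult_nonpos_nonneg)
  then show ?thesis
    using assms by (simp add: eulerian_spline_def eulerian_op_linear_power_reversal min_def)
qed

lemma eulerian_spline_0:
  "n > 0 \<Longrightarrow> eulerian_spline t n 0 = poly (eulerian_poly n) t"
  using eulerian_op_monom[of n] by (simp add: eulerian_spline_def monom_altdef)

lemma eulerian_spline_twist: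
  "t < 0 \<Longrightarrow> n > 0 \<Longrightarrow> eulerian_spline t n t = t * eulerian_spline t n 1"
  using eulerian_op_linear_power_twist[of t n] by (simp add: eulerian_spline_def)

lemma eulerian_op_linear_power_deriv:
  "((\<lambda>q. poly (eulerian_op ([:q, 1:] ^ Suc n)) t) has_real_derivative
     real (Suc n) * poly (eulerian_op ([:q, 1:] ^ n)) t) (at q)"
proof -
  let ?A = "\<lambda>k. poly (eulerian_poly k) t"
  have "((\<lambda>q. \<Sum>k\<le>Suc n. real (Suc n choose k) * q ^ (Suc n - k) * ?A k) has_real_derivative
      (\<Sum>k\<le>Suc n. real (Suc n choose k) * (real (Suc n - k) * q ^ (Suc n - k - 1)) * ?A k)) (at q)"
    by (auto intro!: derivative_eq_intros sum.cong simp: mult_ac)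
  also have "(\<Sum>k\<le>Suc n. real (Suc n choose k) * (real (Suc n - k) * q ^ (Suc n - k - 1)) * ?A k) =
      (\<Sum>k\<le>n. real (Suc n) * (real (n choose k) * q ^ (n - k) * ?A k))"
  proof -
    have "real (Suc n choose k) * real (Suc n - k) = real (Suc n) * real (n choose k)" if "k \<le> n" for k
    proof -
      have "(Suc n - k) * (Suc n choose k) = Suc n * (n choose k)"
        using binomial_absorb_comp[of "Suc n" k] by simp
      from arg_cong[OF this, of real] show ?thesis
        by (simp only: of_nat_mult mult.commute)
    qed
    then show ?thesis
      by (auto intro!: sum.cong simp: mult.assoc[symmetric] simp del: of_nat_Suc binomial_Suc_Suc)
  qed
  finally show ?thesis
    by (simp only: poly_eulerian_op_linear_power sum_distrib_left)
qed

lemma min_0_power_deriv: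
  assumes "n > 0"
  shows "((\<lambda>q::real. min q 0 ^ Suc n) has_real_derivative real (Suc n) * min q 0 ^ n) (at q)"
proof -
  consider "q > 0" | "q < 0" | "q = 0" by linarith
  then show ?thesis
  proof cases
    case 1
    have *: "((\<lambda>q::real. 0) has_real_derivative real (Suc n) * min q 0 ^ n) (at q)"
      using 1 assms by (simp add: zero_power)
    have ev: "eventually (\<lambda>x. 0 = min x 0 ^ Suc n) (nhds q)"
      using eventually_nhds_in_open[of "{0<..}" q] 1 by (auto elim!: eventually_mono)
    from * show ?thesis by (rule DERIV_cong_ev[OF refl ev refl, THEN iffD1])
  next
    case 2
    have *: "((\<lambda>q::real. q ^ Suc n) has_real_derivative real (Suc n) * min q 0 ^ n) (at q)"
      using DERIV_pow[of "Suc n" q UNIV] 2 by simp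
    have ev: "eventually (\<lambda>x. x ^ Suc n = min x 0 ^ Suc n) (nhds q)"
      using eventually_nhds_in_open[of "{..<0}" q] 2 by (auto elim!: eventually_mono)
    from * show ?thesis by (rule DERIV_cong_ev[OF refl ev refl, THEN iffD1])
  next
    case 3
    \<comment> \<open>At the knot the difference quotient is itself the truncated power of one degree less.\<close>
    have "isCont (\<lambda>x::real. min x 0 ^ n) 0"
      by (intro continuous_intros)
    moreover have "min x 0 ^ Suc n = min x 0 ^ n * x" for x :: real
      using assms by (auto simp: min_def)
    ultimately show ?thesis
      unfolding CARAT_DERIV 3 using assms by (intro exI[of _ "\<lambda>x. min x 0 ^ n"]) auto
  qed
qed

lemma eulerian_spline_deriv:
  "n > 0 \<Longrightarrow> (eulerian_spline t (Suc n) has_real_derivative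
     real (Suc n) * eulerian_spline t n q) (at q)"
  unfolding eulerian_spline_def
  by (rule DERIV_cong, rule DERIV_diff[OF eulerian_op_linear_power_deriv DERIV_cmult[OF min_0_power_deriv]])
    (simp_all add: algebra_simps)

lemma eulerian_spline_cont: "isCont (eulerian_spline t n) q"
  unfolding eulerian_spline_def poly_eulerian_op_linear_power by (intro continuous_intros)

lemma eulerian_spline_1: "eulerian_spline t 1 q = q + t - (1 - t) * min q 0"
  unfolding eulerian_spline_def poly_eulerian_op_linear_power
  by (simp add: eulerian_poly_Suc eulerian_poly_0 pderiv_1)

text \<open>By induction with \<open>twisted_Rolle\<close>. The induction starts at \<open>n = 1\<close>, since the derivative of that
  spline jumps at \<open>0\<close>; its zero is \<open>-t\<close> or \<open>-1\<close>, according to which of the two lies in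
  the interval.\<close>

lemma eulerian_spline_unique_zero:
  assumes t: "t < 0" and "n > 0"
    and "x \<in> {t..<1}" "y \<in> {t..<1}" "eulerian_spline t n x = 0" "eulerian_spline t n y = 0"
  shows "x = y"
  using assms(2-)
proof (induction n arbitrary: x y rule: nat_induct_non_zero)
  case 1
  have *: "x = (if t \<le> -1 then -1 else -t)"
    if "x \<in> {t..<1}" "eulerian_spline t 1 x = 0" for x
  proof (cases "x \<ge> 0")
    case True
    then show ?thesis using that t
      unfolding eulerian_spline_1 by auto
  next
    case False
    then have "t * (1 + x) = 0" using that t
      unfolding eulerian_spline_1 by (simp add: algebra_simps)
    then show ?thesis using t that by auto
  qed
  show ?case using *[of x] *[of y] 1 by simp
next
  case (Suc n)
  show ?case
  proof (rule twisted_Rolle[where f = "eulerian_spline t (Suc n)"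
        and f' = "\<lambda>q. real (Suc n) * eulerian_spline t n q" and a = t and b = 1])
    show "x = y" if "x \<in> {t..<1}" "y \<in> {t..<1}"
        "real (Suc n) * eulerian_spline t n x = 0" "real (Suc n) * eulerian_spline t n y = 0" for x y
      using that Suc.IH[of x y] by (simp del: of_nat_Suc)
    show "isCont (\<lambda>q. real (Suc n) * eulerian_spline t n q) x" for x
      by (intro continuous_intros eulerian_spline_cont)
  qed (use t Suc eulerian_spline_twist eulerian_spline_deriv in auto)
qed

text \<open>When \<open>0\<close> is a zero of the spline, it is the only one on \<open>[t,1]\<close>, so the slope at \<open>0\<close> determines all
  signs. The factor \<open>c\<close> stands for an arbitrary number with the sign of this slope.\<close>

lemma eulerian_spline_sign_at_zero:
  assumes t: "t < 0" and n: "n > 0" and zero: "poly (eulerian_poly (Suc n)) t = 0"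
    and c: "c * poly (eulerian_poly n) t > 0" and q: "0 < q" "q \<le> 1"
  shows "c * eulerian_spline t (Suc n) q > 0" "c * eulerian_spline t (Suc n) (t * q) < 0"
proof -
  define h where "h x = c * eulerian_spline t (Suc n) x" for x
  have h0: "h 0 = 0" using zero by (simp add: h_def eulerian_spline_0)
  have c0: "c \<noteq> 0" using c by auto
  have nz: "h x \<noteq> 0" if "x \<in> {t..1}" "x \<noteq> 0" for x
  proof (cases "x = 1")
    case False
    then show ?thesis
      using eulerian_spline_unique_zero[OF t, of "Suc n" x 0] that t c0 zero
      by (auto simp: h_def eulerian_spline_0)
  next
    case True
    have "eulerian_spline t (Suc n) t \<noteq> 0"
      using eulerian_spline_unique_zero[OF t, of "Suc n" t 0] t zero
      by (auto simp: eulerian_spline_0)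
    then show ?thesis using True t c0 eulerian_spline_twist[OF t] by (auto simp: h_def)
  qed
  have cont: "isCont h x" for x
    unfolding h_def by (intro continuous_intros eulerian_spline_cont)
  have "(h has_real_derivative c * (real (Suc n) * eulerian_spline t n 0)) (at 0)"
    unfolding h_def by (intro DERIV_cmult eulerian_spline_deriv n)
  moreover have "c * (real (Suc n) * eulerian_spline t n 0) > 0"
  proof -
    have "real (Suc n) * (c * poly (eulerian_poly n) t) > 0"
      using mult_pos_pos[OF _ c, of "real (Suc n)"] by simp
    then show ?thesis using n by (simp add: eulerian_spline_0 algebra_simps)
  qed
  ultimately obtain d1 d2 where d1: "d1 > 0" "\<And>e. 0 < e \<Longrightarrow> e < d1 \<Longrightarrow> h e > 0"
    and d2: "d2 > 0" "\<And>e. 0 < e \<Longrightarrow> e < d2 \<Longrightarrow> h (- e) < 0"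
    using DERIV_pos_inc_right[of h _ 0] DERIV_pos_inc_left[of h _ 0] h0 by (metis add_0 diff_0)
  show "c * eulerian_spline t (Suc n) q > 0"
  proof (rule ccontr)
    assume "\<not> c * eulerian_spline t (Suc n) q > 0"
    then have "h q \<le> 0" by (simp add: h_def)
    define e where "e = min q d1 / 2"
    have e: "0 < e" "e < d1" "e < q" using q d1 by (auto simp: e_def min_def)
    then obtain z where "e \<le> z" "z \<le> q" "h z = 0"
      using IVT2[of h q 0 e] \<open>h q \<le> 0\<close> d1 cont by force
    then show False using nz[of z] e q t by auto
  qed
  show "c * eulerian_spline t (Suc n) (t * q) < 0"
  proof (rule ccontr)
    assume "\<not> c * eulerian_spline t (Suc n) (t * q) < 0"
    then have hq: "h (t * q) \<ge> 0" by (simp add: h_def)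
    have tq: "t \<le> t * q" "t * q < 0"
      using t q by (auto simp: mult_neg_pos)
    have "0 < min (- (t * q)) d2"
      using tq(2) d2(1) by (simp only: min_less_iff_conj) simp
    then obtain e where e: "0 < e" "e < d2" "e < - (t * q)"
      using dense[of 0 "min (- (t * q)) d2"] by (auto simp only: min_less_iff_conj)
    then obtain z where "t * q \<le> z" "z \<le> - e" "h z = 0"
      using IVT2[of h "-e" 0 "t * q"] hq d2(2)[of e] cont by force
    then show False using nz[of z] e tq q by auto
  qed
qed

text \<open>Equal values at \<open>t * q\<close> and \<open>q\<close> that are zero or differ in sign from the value at \<open>0\<close> between them
  would force a zero on each side of \<open>0\<close>.\<close>

lemma eulerian_spline_sign_at_level:
  assumes t: "t < 0" and n: "n > 0" and A: "poly (eulerian_poly n) t \<noteq> 0"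
    and q: "0 < q" "q < 1" and level: "eulerian_spline t n q = eulerian_spline t n (t * q)"
  shows "eulerian_spline t n q * poly (eulerian_poly n) t > 0"
proof (rule ccontr)
  assume neg: "\<not> eulerian_spline t n q * poly (eulerian_poly n) t > 0"
  define h where "h x = poly (eulerian_poly n) t * eulerian_spline t n x" for x
  have "h 0 > 0"
    using A n by (auto simp: h_def eulerian_spline_0 zero_less_mult_iff)
  moreover have "h q \<le> 0"
    using neg by (simp add: h_def mult.commute not_less)
  ultimately have h: "h 0 > 0" "h q \<le> 0" .
  then have htq: "h (t * q) \<le> 0"
    by (simp add: h_def level)
  have cont: "isCont h x" for x
    unfolding h_def by (intro continuous_intros eulerian_spline_cont)
  have tq: "t < t * q" "t * q < 0"
    using t q by (auto simp: mult_neg_pos)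
  obtain x where x: "0 \<le> x" "x \<le> q" "h x = 0"
    using IVT2[of h q 0 0] h q cont by auto
  obtain y where y: "t * q \<le> y" "y \<le> 0" "h y = 0"
    using IVT[of h "t * q" 0 0] h htq tq cont by auto
  have "t \<le> y"
    using tq(1) y(1) by linarith
  have "x = y"
    by (rule eulerian_spline_unique_zero[OF t n, rotated 2]) (use \<open>t \<le> y\<close> x y q t A in \<open>auto simp: h_def\<close>)
  then show False using x y h by auto
qed

section \<open>Symmetric decompositions\<close>

lemma poly_zero_almost_everywhere:
  fixes p :: "real poly"
  assumes "finite S" "\<And>t. t \<notin> S \<Longrightarrow> poly p t = 0"
  shows "p = 0"
proof (rule ccontr)
  assume "p \<noteq> 0"
  then have "finite (S \<union> {t. poly p t = 0})"
    using assms(1) poly_roots_finite by blast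
  moreover have "S \<union> {t. poly p t = 0} = UNIV"
    using assms(2) by blast
  ultimately show False
    using infinite_UNIV_char_0 by metis
qed

text \<open>The difference of \<open>f\<close> and its reversal vanishes at \<open>1\<close>, and \<open>b\<close> is its quotient by \<open>t - 1\<close>. The
  coefficients are recorded because they show when the degrees are exactly \<open>m + 1\<close> and \<open>m\<close>.\<close>

lemma symmetric_decomposition_exists:
  assumes deg: "degree f = Suc m"
  obtains a b where "symmetric_decomposition (Suc m) f a b"
    "degree a \<le> Suc m" "coeff a (Suc m) = poly f 0" "poly a 0 = poly f 0"
    "degree b \<le> m" "coeff b m = lead_coeff f - poly f 0"
proof -
  define R where "R = reflect_poly f"
  have R: "poly R t = t ^ Suc m * poly f (1 / t)" if "t \<noteq> 0" for t
    using poly_reflect_poly_nz[OF that, of f] deg by (simp add: R_def inverse_eq_divide)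
  have degR: "degree R \<le> Suc m"
    using degree_reflect_poly_le[of f] deg by (simp add: R_def)
  have "poly (f - R) 1 = 0" by (simp add: R)
  then obtain b where b: "f - R = [:-1, 1:] * b"
    using poly_eq_0_iff_dvd[of "f - R" 1] by (auto elim: dvdE)
  define a where "a = f - [:0, 1:] * b"
  have degb: "degree b \<le> m"
  proof (cases "b = 0")
    case False
    then have "Suc (degree b) = degree (f - R)"
      unfolding b by (subst degree_mult_eq) auto
    also have "\<dots> \<le> Suc m" using deg degR by (intro degree_diff_le) auto
    finally show ?thesis by simp
  qed simp
  have f: "poly f t = poly R t + (t - 1) * poly b t" for t
    using arg_cong[OF b, of "\<lambda>p. poly p t"] by (simp add: algebra_simps)
  have f_inv: "t ^ Suc m * poly f (1 / t) = poly R t" "t ^ Suc m * poly R (1 / t) = poly f t"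
    if "t \<noteq> 0" for t
    using R[OF that] R[of "1 / t"] that by (auto simp: power_divide)
  have b_val: "poly b t = (poly R t - poly f t) / (1 - t)" if "t \<noteq> 1" for t
    using f[of t] that by (simp add: field_simps)
  have b_sym: "t ^ Suc m * poly b (1 / t) = t * poly b t" if "t \<noteq> 0" for t
  proof (cases "t = 1")
    case False
    have "t ^ Suc m * poly b (1 / t) =
        (t ^ Suc m * poly R (1 / t) - t ^ Suc m * poly f (1 / t)) / (1 - 1 / t)"
      using b_val[of "1 / t"] that False by (simp add: right_diff_distrib)
    also have "\<dots> = (poly f t - poly R t) / (1 - 1 / t)"
      by (simp only: f_inv[OF that])
    also have "\<dots> = t * poly b t"
      using that False by (simp add: b_val divide_simps) (simp add: algebra_simps)
    finally show ?thesis .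
  qed simp
  have "symmetric_decomposition (Suc m) f a b"
    unfolding symmetric_decomposition_def
  proof (intro conjI allI impI)
    fix t :: real assume t: "t \<noteq> 0"
    have "t ^ Suc m * poly a (1 / t) = t ^ Suc m * poly f (1 / t) - (t ^ Suc m * poly b (1 / t)) / t"
      by (simp add: a_def right_diff_distrib)
    also have "\<dots> = poly R t - poly b t"
      using t by (simp only: f_inv[OF t] b_sym[OF t]) simp
    also have "\<dots> = poly a t"
      using f[of t] by (simp add: a_def algebra_simps)
    finally show "poly a t = t ^ Suc m * poly a (1 / t)" ..
    show "poly b t = t powi (int (Suc m) - 1) * poly b (1 / t)"
      using b_sym[OF t] t by simp
  qed (simp add: a_def)
  moreover have "degree a \<le> Suc m"
    unfolding a_def using deg degb by (intro degree_diff_le) (auto intro: order.trans[OF degree_mult_le])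
  moreover have cb: "coeff b m = lead_coeff f - poly f 0"
  proof -
    have "coeff (f - R) (Suc m) = coeff b m"
      unfolding b using degb by (simp add: coeff_eq_0)
    moreover have "coeff R (Suc m) = poly f 0"
      by (simp add: R_def coeff_reflect_poly deg poly_0_coeff_0)
    ultimately show ?thesis using deg by simp
  qed
  moreover have "coeff a (Suc m) = poly f 0"
    using cb deg by (simp add: a_def)
  moreover have "poly a 0 = poly f 0"
    by (simp add: a_def)
  ultimately show ?thesis using that degb by blast
qed

section \<open>The interlacing decomposition\<close>

theorem corollary4p6:
  fixes n :: nat
  shows "\<forall>q::real. 0 \<le> q \<and> q \<le> 1 \<longrightarrow>
    interlacing_symmetric_decomposition n (eulerian_op ([:q, 1:] ^ n))"
proof (intro allI impI)
  fix q :: real assume q: "0 \<le> q \<and> q \<le> 1"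
  show "interlacing_symmetric_decomposition n (eulerian_op ([:q, 1:] ^ n))"
  proof (cases n)
    case 0
    have "symmetric_decomposition 0 1 1 0" by (simp add: symmetric_decomposition_def)
    moreover have "interlaces 0 1"
      by (simp add: interlaces_def pos_real_rooted_def only_real_zeros_def)
    moreover have "eulerian_op ([:q, 1:] ^ 0) = 1"
      using eulerian_op_monom[of 0] by (simp add: eulerian_poly_0)
    ultimately show ?thesis
      unfolding interlacing_symmetric_decomposition_def 0 by auto
  next
    case (Suc m)
    define F where "F = eulerian_op ([:q, 1:] ^ Suc m)"
    have F: "degree F = Suc m" "lead_coeff F = 1" "poly F 0 = q ^ Suc m"
      unfolding F_def by (rule degree_eulerian_op_linear_power)+
    obtain a b where ab: "symmetric_decomposition (Suc m) F a b"
      and a: "degree a \<le> Suc m" "coeff a (Suc m) = q ^ Suc m" "poly a 0 = q ^ Suc m"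
      and b: "degree b \<le> m" "coeff b m = 1 - q ^ Suc m"
      using symmetric_decomposition_exists[OF F(1)] F by metis
    have a_val: "(1 - t) * poly a t = poly F t - t * (t ^ Suc m * poly F (1 / t))"
      and b_val: "(1 - t) * poly b t = t ^ Suc m * poly F (1 / t) - poly F t"
      if "t \<noteq> 0" "t \<noteq> 1" for t
      using symmetric_decomposition_explicit[OF ab that] that by simp_all
    obtain w where w: "\<And>i. i < m \<Longrightarrow> poly (descent_poly m) (w i) = 0" "\<And>i. i < m \<Longrightarrow> w i < 0"
        "\<And>i. Suc i < m \<Longrightarrow> w (Suc i) < w i"
        "\<And>i. i < m \<Longrightarrow> (-1) ^ i * poly (descent_poly (m - 1)) (w i) > 0"
      using descent_poly_roots[of m] by blast
    have E: "degree (descent_poly m) = m" "lead_coeff (descent_poly m) > 0"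
      by (simp_all add: degree_descent_poly lead_coeff_descent_poly)
    have "interlaces b a"
    proof (cases "q = 0")
      case True
      have F0: "F = [:0, 1:] * descent_poly m"
        using eulerian_op_monom[of "Suc m"] True by (simp add: F_def monom_altdef eulerian_poly_Suc_eq)
      have "a = 0"
      proof (rule poly_zero_almost_everywhere[of "{0, 1}"])
        fix t :: real assume "t \<notin> {0, 1}"
        then show "poly a t = 0"
          using a_val[of t] descent_poly_palindromic[of t m] by (simp add: F0)
      qed simp
      then have "b = descent_poly m"
        using ab F0 by (simp add: symmetric_decomposition_def)
      then show ?thesis
        using \<open>a = 0\<close> pos_real_rootedI[OF E, of w, OF w(3,1)] by (simp add: interlaces_def)
    next
      case False
      then have q0: "0 < q" "q \<le> 1" using q by auto
      then have "q ^ Suc m > 0" by (intro zero_less_power)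
      then have coeffs: "coeff a (Suc m) > 0" "poly a 0 > 0"
        using a by (simp_all del: power_Suc)
      then have dega: "degree a = Suc m"
        by (intro antisym[OF a(1)] le_degree) simp
      then have a': "degree a = Suc m" "lead_coeff a > 0" "poly a 0 > 0"
        using coeffs by simp_all
      have a_spline: "(1 - t) * poly a t = eulerian_spline t (Suc m) q - eulerian_spline t (Suc m) (t * q)"
        if "t < 0" for t
        using a_val[of t] that q0
        by (simp add: F_def eulerian_spline_nonneg eulerian_spline_reversal del: power_Suc)
      \<comment> \<open>Along the zeros of the Eulerian polynomial the sign of \<open>a\<close> is that of the preceding Eulerian
        polynomial, which is \<open>w i\<close> times a polynomial of sign \<open>(-1) ^ i\<close>.\<close>
      have sign: "(-1) ^ Suc i * poly a (w i) > 0" if i: "i < m" for i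
      proof -
        obtain l where l: "m = Suc l" using i by (cases m) auto
        have A0: "poly (eulerian_poly (Suc m)) (w i) = 0"
          using w(1)[OF i] by (simp add: eulerian_poly_Suc_eq)
        have "(- w i) * ((-1) ^ i * poly (descent_poly l) (w i)) > 0"
          by (rule mult_pos_pos) (use w(2,4)[OF i] in \<open>simp_all add: l\<close>)
        then have A1: "(-1) ^ Suc i * poly (eulerian_poly m) (w i) > 0"
          unfolding l eulerian_poly_Suc_eq by (simp add: mult_ac)
        have "(-1) ^ Suc i * eulerian_spline (w i) (Suc m) q > 0"
          "(-1) ^ Suc i * eulerian_spline (w i) (Suc m) (w i * q) < 0"
          using eulerian_spline_sign_at_zero[OF w(2)[OF i] _ A0 A1 q0] l by simp_all
        then have "(-1) ^ Suc i * ((1 - w i) * poly a (w i)) > 0"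
          unfolding a_spline[OF w(2)[OF i]] right_diff_distrib by linarith
        then have "(1 - w i) * ((-1) ^ Suc i * poly a (w i)) > 0"
          by (simp only: mult.left_commute)
        then show ?thesis
          by (rule zero_less_mult_pos) (use w(2)[OF i] in simp)
      qed
      obtain r where r_roots: "\<forall>i<Suc m. poly a (r i) = 0 \<and> r i < 0 \<and>
            (\<forall>j<i. r i < w j) \<and> (\<forall>j. i \<le> j \<and> j < m \<longrightarrow> w j < r i)"
          and r_desc: "\<forall>i. Suc i < Suc m \<longrightarrow> r (Suc i) < r i"
        by (rule interlaced_roots[where w = w, OF a' w(2,3) sign, THEN exE];
          (assumption | (elim conjE, rule that; assumption)))
      have r: "poly a (r i) = 0" "r i < 0" if "i < Suc m" for i
        using r_roots that by simp_all
      have r_dec: "r (Suc i) < r i" if "Suc i < Suc m" for i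
        using r_desc that by simp
      show ?thesis
      proof (cases "q = 1")
        case True
        have "b = 0"
        proof (rule poly_zero_almost_everywhere[of "{0, 1}"])
          fix t :: real assume t: "t \<notin> {0, 1}"
          then have "t * (t ^ Suc m * poly F (1 / t)) = t * poly F t"
            using eulerian_op_linear_power_reversal[of t "Suc m" 1]
              eulerian_op_linear_power_twist[of t "Suc m"]
            by (simp only: F_def True mult_1_right) simp
          then show "poly b t = 0"
            using b_val[of t] t by simp
        qed simp
        then show ?thesis
          using pos_real_rootedI[OF a'(1,2), of r, OF r_dec r(1)] by (simp add: interlaces_def)
      next
        case False
        then have q1: "q < 1" using q0 by simp
        have "q ^ Suc m < 1"
          using q0 q1 by (intro power_Suc_less_one) auto
        then have coeff_b: "coeff b m > 0"
          using b by simp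
        then have "degree b = m"
          by (intro antisym[OF b(1)] le_degree) simp
        then have b': "degree b = m" "lead_coeff b > 0"
          using coeff_b by simp_all
        \<comment> \<open>At a zero \<open>r i\<close> of \<open>a\<close> both \<open>t * b\<close> and the Eulerian polynomial \<open>t * descent_poly m\<close> have the sign of
          the spline, so \<open>b\<close> has the sign of \<open>descent_poly m\<close>, whose zeros \<open>w\<close> separate the \<open>r i\<close>.\<close>
        have b_sign: "(-1) ^ i * poly b (r i) > 0" if i: "i < Suc m" for i
        proof -
          let ?t = "r i" and ?v = "eulerian_spline (r i) (Suc m) q"
          have t: "?t < 0" using r(2)[OF i] .
          have E_sign: "(-1) ^ i * poly (descent_poly m) ?t > 0"
            by (rule sign_between_roots[OF E, of w, OF w(3,1)]) (use i r_roots in auto)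
          have level: "?v = eulerian_spline ?t (Suc m) (?t * q)"
            using a_spline[OF t] r(1)[OF i] by simp
          have A: "poly (eulerian_poly (Suc m)) ?t = ?t * poly (descent_poly m) ?t"
            by (simp add: eulerian_poly_Suc_eq)
          have "?v * poly (eulerian_poly (Suc m)) ?t > 0"
            by (rule eulerian_spline_sign_at_level[OF t _ _ q0(1) q1 level])
              (use t E_sign A in auto)
          moreover have "?t * poly b ?t = ?v"
          proof -
            have "poly F ?t = ?t * poly b ?t"
              using ab r(1)[OF i] by (simp add: symmetric_decomposition_def)
            then show ?thesis using q0 by (simp add: F_def eulerian_spline_nonneg)
          qed
          ultimately have "(?t * ?t) * (poly b ?t * poly (descent_poly m) ?t) > 0"
            unfolding A by (metis mult.assoc mult.left_commute)
          then have "poly b ?t * poly (descent_poly m) ?t > 0"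
            using t by (simp add: zero_less_mult_iff)
          then have "((-1) ^ i * poly b ?t) * ((-1) ^ i * poly (descent_poly m) ?t) > 0"
            by (simp add: algebra_simps flip: power_add mult_2)
          then show ?thesis
            using E_sign by (rule zero_less_mult_pos2)
        qed
        obtain s where s: "\<And>i. i < m \<Longrightarrow> r (Suc i) < s i \<and> s i < r i \<and> poly b (s i) = 0"
          using alternating_signs_roots[of m r b] r_dec b_sign by auto
        show ?thesis
          by (rule interlacesI[where r = r and s = s, OF a'(1,2) r_dec r(1) b' s])
      qed
    qed
    then show ?thesis
      unfolding interlacing_symmetric_decomposition_def Suc using ab F(1) by (auto simp: F_def)
  qed
qed

end
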